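(* Let $n,m\ge 1$ and let $\Phi$ be a linear operator on $M_{n,m}$. Then $\Phi$ preserves strong majorization on $\Omega^{col}_{n,m}$ if and only if there exist $S_1,\ldots,S_m\in M_{n,m}$, $R\in M_m$ and $P\in P(n)$ such that $$\Phi(X)=\sum_{j=1}^{m}(e^tX^{(j)})S_j+PXR\quad\text{for all }X\in M_{n,m},$$ and moreover, if $R\neq 0$, then $\sum_{j=1}^m S_j=ev^t$ for some $v\in\mathbb{R}^m$.
   Context: $M_{n,m}$ is the space of real $n\times m$ matrices and $M_m=M_{m,m}$. $X^{(j)}$ is the $j$-th column of $X$. Vectors are columns; $e=(1,\ldots,1)^t$ denotes the all-ones vector (here $e\in\mathbb{R}^n$). $P(n)$ is the set of $n\times n$ permutation matrices. $\Omega_n$ is the set of doubly stochastic $n\times n$ matrices (nonnegative, all row and column sums equal to $1$). $\Omega^{col}_{n,m}$ is the set of column stochastic $n\times m$ matrices (nonnegative, every column sum equal to $1$). Strong majorization: for $A,B\in M_{n,m}$, $A\preceq^s B$ means $A=DB$ for some $D\in\Omega_n$. A linear operator $\Phi$ on $M_{n,m}$ (i.e. a linear map $M_{n,m}\to M_{n,m}$) preserves strong majorization on $\Omega^{col}_{n,m}$ if $A\preceq^s B$ implies $\Phi(A)\preceq^s\Phi(B)$ for all $A,B\in\Omega^{col}_{n,m}$. *)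

theory Defs
  imports "HOL-Analysis.Analysis"
begin

text \<open>The space of real \<open>n\<close> by \<open>m\<close> matrices is \<open>real ^ 'm ^ 'n\<close>: rows are indexed by \<open>'n\<close>,
  columns by \<open>'m\<close>, so \<open>n = CARD('n)\<close> and \<open>m = CARD('m)\<close> are arbitrary positive numbers.\<close>

definition ones :: "real ^ 'n" where
  "ones = (\<chi> i. 1)"

definition permutation_matrices :: "(real ^ 'n ^ 'n) set" where
  "permutation_matrices = {(\<chi> i j. if j = p i then 1 else 0) | p. p permutes (UNIV :: 'n set)}"

definition doubly_stochastic :: "(real ^ 'n ^ 'n) set" where
  "doubly_stochastic =
     {D. (\<forall>i j. 0 \<le> D $ i $ j) \<and> (\<forall>i. (\<Sum>j\<in>UNIV. D $ i $ j) = 1)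
       \<and> (\<forall>j. (\<Sum>i\<in>UNIV. D $ i $ j) = 1)}"

definition column_stochastic :: "(real ^ 'm ^ 'n) set" where
  "column_stochastic =
     {X. (\<forall>i j. 0 \<le> X $ i $ j) \<and> (\<forall>j. (\<Sum>i\<in>UNIV. X $ i $ j) = 1)}"

definition strongly_majorized :: "real ^ 'm ^ 'n \<Rightarrow> real ^ 'm ^ 'n \<Rightarrow> bool"  (infix \<open>\<preceq>\<^sub>s\<close> 50) where
  "A \<preceq>\<^sub>s B \<longleftrightarrow> (\<exists>D\<in>doubly_stochastic. A = D ** B)"

definition preserves_strong_majorization_on ::
  "(real ^ 'm ^ 'n) set \<Rightarrow> (real ^ 'm ^ 'n \<Rightarrow> real ^ 'm ^ 'n) \<Rightarrow> bool" where
  "preserves_strong_majorization_on \<Omega> \<Phi> \<longleftrightarrow>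
     (\<forall>A\<in>\<Omega>. \<forall>B\<in>\<Omega>. A \<preceq>\<^sub>s B \<longrightarrow> \<Phi> A \<preceq>\<^sub>s \<Phi> B)"

text \<open>The rank-one matrix \<open>u v\<^sup>t\<close>, as the product of an \<open>n\<close> by \<open>1\<close> and a \<open>1\<close> by \<open>m\<close> matrix.\<close>

definition outer_product :: "real ^ 'n \<Rightarrow> real ^ 'm \<Rightarrow> real ^ 'm ^ 'n" where
  "outer_product u v = (columnvector u :: real ^ 1 ^ 'n) ** (rowvector v :: real ^ 'm ^ 1)"

end

theory Submission
  imports Defs
begin

text \<open>
  Necessity is the substantial direction. Let \<open>E\<close> be the matrix with all entries \<open>1/n\<close>. Every
  column stochastic matrix near \<open>E\<close> is \<open>E + Y\<close> with \<open>Y\<close> having zero column sums, so \<open>\<Phi>\<close> is studied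
  through the rows \<open>s\<^sub>i\<close> of \<open>\<Phi> E\<close> and the row functionals \<open>L\<^sub>i\<close> of \<open>X \<mapsto> \<Phi> (C X)\<close>, where \<open>C\<close>
  subtracts from each column its mean.

  If \<open>Q\<close> is a permutation matrix, \<open>B\<close> and \<open>Q B\<close> majorize each other, hence so do \<open>\<Phi> B\<close> and
  \<open>\<Phi> (Q B)\<close>, and mutually majorizing matrices have the same rows
  (\<open>mutually_majorized_rows\<close>, a variance argument). So for each \<open>i\<close> and each small \<open>X\<close>,
  \<open>s\<^sub>i + L\<^sub>i (Q X) = s\<^sub>k + L\<^sub>k X\<close> for some \<open>k\<close>. A ball is not a finite union of proper affine
  subspaces (\<open>affine_maps_cover_ball\<close>), so one \<open>k\<close> serves all \<open>X\<close>: \<open>s\<^sub>k = s\<^sub>i\<close> and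
  \<open>L\<^sub>k = L\<^sub>i \<circ> Q\<close> (\<open>preserver_permutes_rows\<close>).

  Regard \<open>L\<^sub>i\<close> as a function \<open>f\<^sub>i\<close> sending a row index \<open>a\<close> to the coefficients with which row \<open>a\<close>
  of \<open>X\<close> enters. The family of the \<open>n\<close> functions \<open>f\<^sub>i\<close> is closed under permuting the argument, so
  each \<open>f\<^sub>i\<close> has an orbit of at most \<open>n\<close> elements. A function on \<open>n\<close> points with so small an orbit is
  constant off one point (\<open>small_orbit_constant_off_point\<close>). Constancy of \<open>f\<^sub>i\<close> means that \<open>L\<^sub>i\<close>
  only sees column sums. If some \<open>f\<^sub>i\<close> is not constant, its orbit has exactly \<open>n\<close> elements and
  therefore exhausts the family: there is a permutation \<open>\<pi>\<close> such that all \<open>L\<^sub>k X\<close> are, up to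
  a common function of the column sums, the same linear image of row \<open>\<pi> k\<close> of \<open>X\<close>, and all \<open>s\<^sub>k\<close>
  are equal. The first fact is the term \<open>P X R\<close>; the second says that \<open>\<Sum>\<^sub>j S\<^sub>j = e v\<^sup>t\<close>. Treating
  all columns and the position \<open>s\<^sub>i\<close> at once is what makes a single \<open>P\<close> appear.

  Conversely, if \<open>\<Sum>\<^sub>j S\<^sub>j = e v\<^sup>t\<close> and \<open>A = D B\<close>, then
  \<open>\<Phi> A = e v\<^sup>t + P D B R = (P D P\<^sup>t) (e v\<^sup>t + P B R)\<close>, as a doubly stochastic matrix fixes \<open>e\<close>.
  If \<open>R = 0\<close>, then \<open>\<Phi>\<close> depends only on column sums and is constant on column stochastic matrices.
\<close>

section \<open>Row permutations and centring of columns\<close>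

definition permute_rows :: "('n \<Rightarrow> 'n) \<Rightarrow> real ^ 'm ^ 'n \<Rightarrow> real ^ 'm ^ 'n" where
  "permute_rows p X = (\<chi> i. X $ p i)"

definition center_columns :: "real ^ 'm ^ 'n \<Rightarrow> real ^ 'm ^ 'n" where
  "center_columns X = (\<chi> i. X $ i - (1 / real CARD('n)) *\<^sub>R (\<Sum>a\<in>UNIV. X $ a))"

definition single_entry :: "'n \<Rightarrow> 'm \<Rightarrow> real ^ 'm ^ 'n" where
  "single_entry a j = (\<chi> i k. if i = a \<and> k = j then 1 else 0)"

lemma row_matrix_mult: "(D ** B) $ i = (\<Sum>k\<in>UNIV. D $ i $ k *\<^sub>R B $ k)"
  for D :: "real ^ 'n ^ 'p" and B :: "real ^ 'm ^ 'n"
  by (simp add: vec_eq_iff matrix_matrix_mult_def)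

lemma permutation_matrix_mult:
  "(\<chi> i j. if j = p i then 1 else 0) ** X = permute_rows p X"
  for p :: "'n::finite \<Rightarrow> 'n" and X :: "real ^ 'm ^ 'n"
  by (simp add: vec_eq_iff matrix_matrix_mult_def permute_rows_def if_distrib[of "\<lambda>c. c * _"]
      cong: if_cong)

lemma permutation_matrix_doubly_stochastic:
  assumes "p permutes (UNIV :: 'n::finite set)"
  shows "(\<chi> i j. if j = p i then 1 else 0) \<in> (doubly_stochastic :: (real ^ 'n ^ 'n) set)"
proof -
  have "(j = p i) = (i = inv p j)" for i j
    using assms by (metis permutes_inverses)
  then have "(\<Sum>i\<in>UNIV. if j = p i then 1 else 0) = (1 :: real)" for j by simp
  then show ?thesis by (simp add: doubly_stochastic_def)
qed

lemma linear_permute_rows: "linear (permute_rows p)"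
  by (rule linearI) (simp_all add: permute_rows_def vec_eq_iff)

lemma linear_center_columns: "linear center_columns"
  by (rule linearI)
    (simp_all add: center_columns_def vec_eq_iff sum.distrib sum_distrib_left algebra_simps)

lemma center_permute_rows:
  assumes "p permutes (UNIV :: 'n::finite set)"
  shows "center_columns (permute_rows p X) = permute_rows p (center_columns (X :: real ^ 'm ^ 'n))"
proof -
  have "(\<Sum>a\<in>UNIV. X $ p a) = (\<Sum>a\<in>UNIV. X $ a)"
    using sum.permute[OF assms, of "\<lambda>a. X $ a"] by (simp add: o_def)
  then show ?thesis by (simp add: center_columns_def permute_rows_def vec_eq_iff)
qed

lemma permute_single_entry:
  assumes "p permutes (UNIV :: 'n::finite set)"
  shows "permute_rows p (single_entry (p a) j) = (single_entry a j :: real ^ 'm ^ 'n)"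
proof -
  have "(p i = p a) = (i = a)" for i using assms by (metis permutes_inverses(2))
  then show ?thesis by (simp add: vec_eq_iff permute_rows_def single_entry_def)
qed

lemma matrix_as_sum_single_entry:
  "X = (\<Sum>a\<in>UNIV. \<Sum>j\<in>UNIV. X $ a $ j *\<^sub>R single_entry a j)" for X :: "real ^ 'm ^ 'n"
proof -
  have "(\<Sum>a\<in>UNIV. \<Sum>j\<in>UNIV. X $ a $ j * (if i = a \<and> k = j then 1 else 0)) = X $ i $ k"
    (is "?s = _") for i k
  proof -
    have "x * (if i = a \<and> k = j then 1 else 0) = (if j = k then if a = i then x else 0 else 0)"
      for a j and x :: real
      by auto
    then show ?thesis by simp
  qed
  then show ?thesis by (simp add: vec_eq_iff single_entry_def)
qed

section \<open>Mutual majorization\<close>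

text \<open>Each row of \<open>D B\<close> is the mean of the rows of \<open>B\<close> under the probability weights in a row of \<open>D\<close>,
  so this is the identity that variance is second moment minus squared mean, summed over the
  rows; the unit column sums of \<open>D\<close> turn the second moments into the squared norm of \<open>B\<close>.\<close>

lemma doubly_stochastic_variance:
  fixes B :: "real ^ 'm ^ 'n"
  assumes "D \<in> doubly_stochastic"
  shows "(\<Sum>i\<in>UNIV. \<Sum>k\<in>UNIV. D $ i $ k * (norm (B $ k - (D ** B) $ i))\<^sup>2)
       = (norm B)\<^sup>2 - (norm (D ** B))\<^sup>2"
proof -
  have rows: "(\<Sum>k\<in>UNIV. D $ i $ k) = 1" and cols: "(\<Sum>i\<in>UNIV. D $ i $ k) = 1" for i k
    using assms by (auto simp: doubly_stochastic_def)
  have expand: "c * (norm (x - y))\<^sup>2 = c * (norm x)\<^sup>2 - 2 * (c *\<^sub>R x \<bullet> y) + c * (norm y)\<^sup>2"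
    for c :: real and x y :: "real ^ 'm"
    unfolding power2_norm_eq_inner inner_diff_left inner_diff_right inner_scaleR_left
      inner_commute[of y x]
    by (simp add: algebra_simps)
  have row: "(\<Sum>k\<in>UNIV. D $ i $ k * (norm (B $ k - (D ** B) $ i))\<^sup>2)
      = (\<Sum>k\<in>UNIV. D $ i $ k * (norm (B $ k))\<^sup>2) - (norm ((D ** B) $ i))\<^sup>2" for i
  proof -
    let ?a = "(D ** B) $ i"
    have "(\<Sum>k\<in>UNIV. D $ i $ k * (norm (B $ k - ?a))\<^sup>2)
        = (\<Sum>k\<in>UNIV. D $ i $ k * (norm (B $ k))\<^sup>2 - 2 * (D $ i $ k *\<^sub>R B $ k \<bullet> ?a)
            + D $ i $ k * (norm ?a)\<^sup>2)"
      by (simp only: expand)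
    also have "\<dots> = (\<Sum>k\<in>UNIV. D $ i $ k * (norm (B $ k))\<^sup>2) - 2 * (?a \<bullet> ?a)
            + (\<Sum>k\<in>UNIV. D $ i $ k) * (norm ?a)\<^sup>2"
      by (simp only: sum.distrib sum_subtractf sum_distrib_left[symmetric]
          sum_distrib_right[symmetric] inner_sum_left[symmetric] row_matrix_mult[symmetric])
    finally show ?thesis by (simp add: rows power2_norm_eq_inner)
  qed
  have norm_rows: "(norm M)\<^sup>2 = (\<Sum>i\<in>UNIV. (norm (M $ i))\<^sup>2)" for M :: "real ^ 'm ^ 'n"
    by (simp add: power2_norm_eq_inner inner_vec_def)
  have "(\<Sum>i\<in>UNIV. \<Sum>k\<in>UNIV. D $ i $ k * (norm (B $ k))\<^sup>2)
      = (\<Sum>k\<in>UNIV. (\<Sum>i\<in>UNIV. D $ i $ k) * (norm (B $ k))\<^sup>2)"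
    by (subst sum.swap) (simp add: sum_distrib_right)
  then show ?thesis
    by (simp only: row sum_subtractf cols norm_rows mult_1)
qed

lemma strongly_majorized_norm_le:
  assumes "A \<preceq>\<^sub>s B" shows "norm A \<le> norm B"
proof -
  obtain D where D: "D \<in> doubly_stochastic" "A = D ** B"
    using assms by (auto simp: strongly_majorized_def)
  have "0 \<le> (\<Sum>i\<in>UNIV. \<Sum>k\<in>UNIV. D $ i $ k * (norm (B $ k - (D ** B) $ i))\<^sup>2)"
    using D(1) by (intro sum_nonneg mult_nonneg_nonneg) (auto simp: doubly_stochastic_def)
  then have "(norm A)\<^sup>2 \<le> (norm B)\<^sup>2"
    using doubly_stochastic_variance[OF D(1), of B] D(2) by simp
  then show ?thesis by (rule power2_le_imp_le) simp
qed

text \<open>The two norms agree, so every variance in the identity above vanishes: each row of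
  \<open>A = D B\<close> is an average of rows of \<open>B\<close> that all coincide with it.\<close>

lemma mutually_majorized_rows:
  fixes A B :: "real ^ 'm ^ 'n"
  assumes "A \<preceq>\<^sub>s B" and "B \<preceq>\<^sub>s A"
  shows "\<exists>k. A $ i = B $ k"
proof -
  obtain D where D: "D \<in> doubly_stochastic" "A = D ** B"
    using assms by (auto simp: strongly_majorized_def)
  have nonneg: "0 \<le> D $ i $ k" and rows: "(\<Sum>k\<in>UNIV. D $ i $ k) = 1" for i k
    using D(1) by (auto simp: doubly_stochastic_def)
  have "(\<Sum>i\<in>UNIV. \<Sum>k\<in>UNIV. D $ i $ k * (norm (B $ k - A $ i))\<^sup>2) = 0"
    using doubly_stochastic_variance[OF D(1), of B] strongly_majorized_norm_le[OF assms(1)]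
      strongly_majorized_norm_le[OF assms(2)] D(2) by simp
  then have zero: "D $ i $ k * (norm (B $ k - A $ i))\<^sup>2 = 0" for k
    by (simp add: sum_nonneg_eq_0_iff sum_nonneg nonneg)
  obtain k where "D $ i $ k \<noteq> 0"
    using rows[of i] by (metis sum.neutral zero_neq_one)
  then show ?thesis using zero[of k] by (auto intro: exI[of _ k])
qed

section \<open>Finite covers by affine subspaces\<close>

text \<open>The zero set of a nonzero affine map lies in a hyperplane or is empty, hence has measure zero,
  and finitely many null sets cannot cover a ball.\<close>

lemma affine_maps_cover_ball:
  fixes f :: "'k \<Rightarrow> 'a::euclidean_space \<Rightarrow> 'b::euclidean_space" and a :: "'k \<Rightarrow> 'b"
  assumes "finite K" and "0 < \<epsilon>"
    and lin: "\<And>k. k \<in> K \<Longrightarrow> linear (f k)"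
    and cover: "\<And>x. x \<in> ball 0 \<epsilon> \<Longrightarrow> \<exists>k\<in>K. a k + f k x = 0"
  shows "\<exists>k\<in>K. a k = 0 \<and> (\<forall>x. f k x = 0)"
proof (rule ccontr)
  assume none: "\<not> ?thesis"
  have "negligible {x. a k + f k x = 0}" if k: "k \<in> K" for k
  proof -
    have "\<exists>b\<in>Basis. adjoint (f k) b \<noteq> 0 \<or> a k \<bullet> b \<noteq> 0"
    proof (rule ccontr)
      assume "\<not> ?thesis"
      then have "f k x \<bullet> b = 0" "a k \<bullet> b = 0" if "b \<in> Basis" for x b
        using adjoint_works[OF lin[OF k], of x b] that by auto
      then have "a k = 0" "f k x = 0" for x by (auto intro: euclidean_eqI)
      then show False using none k by blast
    qed
    then obtain b where b: "adjoint (f k) b \<noteq> 0 \<or> - (a k \<bullet> b) \<noteq> 0" by auto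
    have "{x. a k + f k x = 0} \<subseteq> {x. adjoint (f k) b \<bullet> x = - (a k \<bullet> b)}"
    proof clarify
      fix x assume "a k + f k x = 0"
      then have "(a k + f k x) \<bullet> b = 0" by simp
      then show "adjoint (f k) b \<bullet> x = - (a k \<bullet> b)"
        using adjoint_works[OF lin[OF k], of x b] by (simp add: inner_add_left inner_commute[of x])
    qed
    then show ?thesis using negligible_hyperplane[OF b] negligible_subset by blast
  qed
  then have "negligible (\<Union>k\<in>K. {x. a k + f k x = 0})"
    using \<open>finite K\<close> by (intro negligible_Union) auto
  moreover have "ball 0 \<epsilon> \<subseteq> (\<Union>k\<in>K. {x. a k + f k x = 0})" using cover by blast
  ultimately have "negligible (ball (0::'a) \<epsilon>)" by (rule negligible_subset)
  then show False using open_not_negligible[of "ball (0::'a) \<epsilon>"] \<open>0 < \<epsilon>\<close> by simp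
qed

section \<open>Functions with a small orbit under permutations\<close>

text \<open>Swapping a point \<open>x\<close> of a level set with a point \<open>y\<close> outside it changes the level set by
  exchanging \<open>x\<close> for \<open>y\<close>. The pair \<open>(x, y)\<close> can be read off from the result, so these
  rearrangements of \<open>f\<close> are distinct from each other and from \<open>f\<close> itself.\<close>

lemma level_set_orbit_bound:
  fixes f :: "'n::finite \<Rightarrow> 'b"
  shows "card {x. f x = v} * card {x. f x \<noteq> v} < card {f \<circ> q | q. q permutes UNIV}"
proof -
  let ?K = "{x. f x = v}" and ?L = "{x. f x \<noteq> v}" and ?O = "{f \<circ> q | q. q permutes UNIV}"
  let ?g = "\<lambda>(x, y). f \<circ> Transposition.transpose x y"
  have level: "(f \<circ> Transposition.transpose x y) z = v \<longleftrightarrow> z = y \<or> z \<noteq> x \<and> f z = v"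
    if "x \<in> ?K" "y \<in> ?L" for x y z
    using that by (auto simp: Transposition.transpose_def)
  have "inj_on ?g (?K \<times> ?L)"
  proof (rule inj_onI)
    fix u w assume "u \<in> ?K \<times> ?L" "w \<in> ?K \<times> ?L" "?g u = ?g w"
    then obtain x y x' y' where uw: "u = (x, y)" "w = (x', y')"
      and xy: "f x = v" "f y \<noteq> v" "f x' = v" "f y' \<noteq> v"
      and eq: "f \<circ> Transposition.transpose x y = f \<circ> Transposition.transpose x' y'"
      by auto
    have "z = y \<or> z \<noteq> x \<and> f z = v \<longleftrightarrow> z = y' \<or> z \<noteq> x' \<and> f z = v" for z
      using level[of x y z] level[of x' y' z] xy eq by simp
    then show "u = w" using xy uw by metis
  qed
  then have "card (?g ` (?K \<times> ?L)) = card ?K * card ?L"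
    by (simp add: card_image card_cartesian_product)
  moreover have "f \<notin> ?g ` (?K \<times> ?L)"
  proof
    assume "f \<in> ?g ` (?K \<times> ?L)"
    then obtain x y where xy: "f x = v" "f y \<noteq> v" and "f = f \<circ> Transposition.transpose x y"
      by auto
    then have "f y = f x" by (metis comp_apply transpose_apply_second)
    then show False using xy by simp
  qed
  ultimately have "card (insert f (?g ` (?K \<times> ?L))) = Suc (card ?K * card ?L)" by simp
  moreover have "card (insert f (?g ` (?K \<times> ?L))) \<le> card ?O"
  proof (rule card_mono)
    have "f \<circ> id \<in> ?O" using permutes_id[of "UNIV :: 'n set"] by blast
    moreover have "f \<circ> Transposition.transpose x y \<in> ?O" for x y
      using permutes_swap_id[of x UNIV y] by blast
    ultimately show "insert f (?g ` (?K \<times> ?L)) \<subseteq> ?O" by (simp add: image_subset_iff)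
    show "finite ?O" using finite_permutations[of "UNIV :: 'n set"] by simp
  qed
  ultimately show ?thesis by linarith
qed

text \<open>With level set sizes \<open>k + l = n\<close>, an orbit of more than \<open>k l\<close> and at most \<open>n\<close> elements forces
  \<open>(k - 1) (l - 1) \<le> 0\<close>. So every level set has at most one point, or the complement of some level
  set does. In the first case \<open>f\<close> is injective with an orbit of size \<open>n!\<close>, hence \<open>n \<le> 2\<close>.\<close>

lemma small_orbit_constant_off_point:
  fixes f :: "'n::finite \<Rightarrow> 'b"
  assumes orbit: "card {f \<circ> q | q. q permutes UNIV} \<le> CARD('n)"
  obtains p c where "\<And>a. a \<noteq> p \<Longrightarrow> f a = c"
proof -
  have split: "card {x. f x = v} + card {x. f x \<noteq> v} = CARD('n)" for v
    using card_Int_Diff[of "UNIV :: 'n set" "{x. f x = v}"]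
    by (simp add: Compl_eq_Diff_UNIV[symmetric] Collect_neg_eq[symmetric])
  have classes: "card {x. f x = v} \<le> 1 \<or> card {x. f x \<noteq> v} \<le> 1" for v
  proof (rule ccontr)
    assume "\<not> ?thesis"
    then have "2 \<le> card {x. f x = v}" "2 \<le> card {x. f x \<noteq> v}" by auto
    then obtain k l where "card {x. f x = v} = 2 + k" "card {x. f x \<noteq> v} = 2 + l"
      using le_Suc_ex by meson
    then show False
      using level_set_orbit_bound[of f v] orbit split[of v] by (simp add: algebra_simps)
  qed
  show ?thesis
  proof (cases "\<exists>v. card {x. f x \<noteq> v} \<le> 1")
    case True
    then obtain v where "card {x. f x \<noteq> v} \<le> 1" by blast
    then have "\<exists>p. {x. f x \<noteq> v} \<subseteq> {p}"
      using card_le_Suc0_iff_eq[of "{x. f x \<noteq> v}"] by (auto simp: subset_iff) metis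
    then show ?thesis using that by blast
  next
    case False
    then have "card {x. f x = v} \<le> 1" for v using classes by blast
    then have "inj f"
      using card_le_Suc0_iff_eq[of "{x. f x = _}"] by (auto intro!: injI)
    then have "inj_on (\<lambda>q. f \<circ> q) {q. q permutes UNIV}"
      by (auto intro!: inj_onI simp: fun_eq_iff inj_eq)
    moreover have "{f \<circ> q | q. q permutes UNIV} = (\<lambda>q. f \<circ> q) ` {q. q permutes UNIV}" by blast
    ultimately have "card {f \<circ> q | q. q permutes UNIV} = fact CARD('n)"
      using card_permutations[of "UNIV :: 'n set" "CARD('n)"] by (simp add: card_image)
    then have "fact CARD('n) \<le> CARD('n)" using orbit by simp
    moreover have "n \<le> 2" if "fact n \<le> n" for n :: nat
    proof (rule ccontr)
      assume "\<not> n \<le> 2"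
      then have "2 < n" by simp
      moreover have "n - 1 \<le> fact (n - 1)" by (rule fact_ge_self)
      moreover have "fact n = n * fact (n - 1)" using \<open>2 < n\<close> by (simp add: fact_reduce)
      ultimately have "n * 2 \<le> n" 
        using that mult_le_mono2[of 2 "fact (n - 1)" n] by linarith
      then show False using \<open>2 < n\<close> by simp
    qed
    ultimately have "CARD('n) \<le> 2" by blast
    \<comment> \<open>On at most two points the level set of any value taken, here at an arbitrary point, omits at
      most one point.\<close>
    then have "card {x. f x \<noteq> f undefined} \<le> 1"
      using split[of "f undefined"] card_gt_0_iff[of "{x. f x = f undefined}"]
      by fastforce
    then show ?thesis using False by blast
  qed
qed

text \<open>A family of \<open>n\<close> functions closed under rearrangement either consists of constants or is the
  orbit of a single function with one exceptional value, the exceptional point running once through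
  all positions. In the latter case one orbit exhausts the indices, so a label \<open>s\<close> that
  every rearrangement preserves is constant.\<close>

lemma closed_family_constant_or_spikes:
  fixes f :: "'n::finite \<Rightarrow> 'n \<Rightarrow> 'b" and s :: "'n \<Rightarrow> 'c"
  assumes closed: "\<And>q i. q permutes UNIV \<Longrightarrow> \<exists>k. s k = s i \<and> f k = f i \<circ> q"
  shows "(\<forall>i. \<exists>c. f i = (\<lambda>_. c)) \<or>
    (\<exists>\<pi> c d. \<pi> permutes UNIV \<and> (\<forall>k. f k = (\<lambda>a. if a = \<pi> k then d else c)) \<and> (\<forall>k i. s k = s i))"
proof (cases "\<forall>i. \<exists>c. f i = (\<lambda>_. c)")
  case False
  then obtain i where nonconst: "\<And>c. f i \<noteq> (\<lambda>_. c)" by blast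
  have "{f i \<circ> q | q. q permutes UNIV} \<subseteq> range f"
  proof clarify
    fix q :: "'n \<Rightarrow> 'n" assume "q permutes UNIV"
    then obtain k where "f k = f i \<circ> q" using closed by blast
    then show "f i \<circ> q \<in> range f" by (metis rangeI)
  qed
  then have "card {f i \<circ> q | q. q permutes UNIV} \<le> CARD('n)"
    by (rule order.trans[OF card_mono[OF finite_imageI[OF finite]] card_image_le[OF finite]])
  then obtain p c where off: "\<And>a. a \<noteq> p \<Longrightarrow> f i a = c"
    by (rule small_orbit_constant_off_point) blast
  define d where "d = f i p"
  have fi: "f i = (\<lambda>a. if a = p then d else c)" using off by (auto simp: d_def)
  have "d \<noteq> c" using nonconst[of c] fi by auto
  \<comment> \<open>Every position \<open>b\<close> of the exceptional point occurs; there are as many positions as indices.\<close>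
  have "\<exists>k. s k = s i \<and> f k = (\<lambda>a. if a = b then d else c)" for b
  proof -
    have "f i \<circ> Transposition.transpose b p = (\<lambda>a. if a = b then d else c)"
      by (auto simp: fi fun_eq_iff Transposition.transpose_def)
    then show ?thesis
      using closed[OF permutes_swap_id[of b UNIV p], of i] by simp
  qed
  then obtain \<kappa> where \<kappa>: "\<And>b. s (\<kappa> b) = s i" "\<And>b. f (\<kappa> b) = (\<lambda>a. if a = b then d else c)"
    by metis
  have "inj \<kappa>"
  proof (rule injI)
    fix b b' assume "\<kappa> b = \<kappa> b'"
    then have "(if b = b then d else c) = (if b = b' then d else c)" using \<kappa>(2) by metis
    then show "b = b'" using \<open>d \<noteq> c\<close> by (auto split: if_splits)
  qed
  then have bij: "bij \<kappa>" by (simp add: finite_UNIV_inj_surj bij_def)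
  then have surj: "\<kappa> (inv \<kappa> k) = k" for k by (simp add: bij_is_surj surj_f_inv_f)
  have "inv \<kappa> permutes UNIV" using bij_imp_bij_inv[OF bij] by (rule bij_imp_permutes) simp
  moreover have "f k = (\<lambda>a. if a = inv \<kappa> k then d else c)" "s k = s i" for k
    using \<kappa>[of "inv \<kappa> k"] by (simp_all add: surj)
  ultimately show ?thesis by metis
qed simp

section \<open>The form of a preserver\<close>

text \<open>Permuting the rows of an argument permutes the affine row functionals of \<open>\<Phi>\<close> near \<open>E\<close>, with
  an index \<open>k\<close> that does not depend on the argument.\<close>

lemma preserver_permutes_rows:
  fixes \<Phi> :: "real ^ 'm ^ 'n \<Rightarrow> real ^ 'm ^ 'n"
  assumes lin: "linear \<Phi>"
    and pres: "preserves_strong_majorization_on column_stochastic \<Phi>"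
    and q: "q permutes UNIV"
  defines "E \<equiv> \<chi> i j. 1 / real CARD('n)"
  shows "\<exists>k. \<Phi> E $ k = \<Phi> E $ i \<and>
    (\<forall>X. \<Phi> (center_columns X) $ k = \<Phi> (center_columns (permute_rows q X)) $ i)"
proof -
  let ?n = "real CARD('n)"
  define a where "a k = \<Phi> E $ i - \<Phi> E $ k" for k
  define f where "f k X = \<Phi> (center_columns (permute_rows q X)) $ i - \<Phi> (center_columns X) $ k"
    for k X
  note maps = linear_add[OF lin] linear_scale[OF lin] linear_add[OF linear_center_columns]
    linear_scale[OF linear_center_columns] linear_add[OF linear_permute_rows]
    linear_scale[OF linear_permute_rows]
  have lin_f: "linear (f k)" for k
    by (rule linearI) (simp_all add: f_def maps scaleR_diff_right)
  have majorized: "permute_rows p B \<preceq>\<^sub>s B" if "p permutes UNIV" for p and B :: "real ^ 'm ^ 'n"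
    unfolding strongly_majorized_def permutation_matrix_mult[symmetric]
    using permutation_matrix_doubly_stochastic[OF that] by blast
  \<comment> \<open>An entry of \<open>C X\<close> is an entry of \<open>X\<close> minus a mean of entries, so the radius
    \<open>1 / (2 n)\<close> keeps it at least \<open>-1/n\<close>, and \<open>E + C X\<close> stays nonnegative.\<close>
  have cover: "\<exists>k\<in>UNIV. a k + f k X = 0" if X: "X \<in> ball 0 (1 / (2 * ?n))" for X
  proof -
    let ?B = "E + center_columns X"
    have small: "\<bar>X $ r $ j\<bar> \<le> 1 / (2 * ?n)" for r j
      using X component_le_norm_cart[of "X $ r" j] Finite_Cartesian_Product.norm_nth_le[of X r]
      by simp
    have nonneg: "0 \<le> ?B $ r $ j" for r j
    proof -
      have "(\<Sum>a\<in>UNIV. X $ a $ j) \<le> (\<Sum>a\<in>(UNIV :: 'n set). 1 / (2 * ?n))"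
        using small by (intro sum_mono) (meson abs_le_iff)
      then have "(\<Sum>a\<in>UNIV. X $ a $ j) \<le> 1 / 2" by simp
      then have "(\<Sum>a\<in>UNIV. X $ a $ j) / ?n \<le> (1 / 2) / ?n" by (intro divide_right_mono) auto
      then show ?thesis using small[of r j] by (simp add: E_def center_columns_def)
    qed
    have "(\<Sum>r\<in>UNIV. ?B $ r $ j) = 1" for j
      by (simp add: E_def center_columns_def sum.distrib sum_subtractf)
    then have B: "?B \<in> column_stochastic" using nonneg by (simp add: column_stochastic_def)
    have QB: "permute_rows q ?B \<in> column_stochastic"
    proof -
      have "(\<Sum>r\<in>UNIV. ?B $ q r $ j) = (\<Sum>r\<in>UNIV. ?B $ r $ j)" for j
        using sum.permute[OF q, of "\<lambda>r. ?B $ r $ j"] by (simp add: o_def)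
      then show ?thesis using B by (simp add: column_stochastic_def permute_rows_def)
    qed
    have inv: "permute_rows (inv q) (permute_rows q ?B) = ?B"
      using permutes_inverses[OF q] by (simp add: permute_rows_def vec_eq_iff)
    have "\<Phi> (permute_rows q ?B) \<preceq>\<^sub>s \<Phi> ?B" "\<Phi> ?B \<preceq>\<^sub>s \<Phi> (permute_rows q ?B)"
      using pres B QB majorized[OF q, of ?B]
        majorized[OF permutes_inv[OF q], of "permute_rows q ?B"] inv
      by (auto simp: preserves_strong_majorization_on_def)
    then obtain k where "\<Phi> (permute_rows q ?B) $ i = \<Phi> ?B $ k"
      using mutually_majorized_rows by blast
    moreover have "permute_rows q ?B = E + center_columns (permute_rows q X)"
      by (simp add: center_permute_rows[OF q] maps) (simp add: permute_rows_def E_def vec_eq_iff)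
    ultimately have "\<Phi> E $ i + \<Phi> (center_columns (permute_rows q X)) $ i
        = \<Phi> E $ k + \<Phi> (center_columns X) $ k"
      by (simp only: linear_add[OF lin] vector_add_component)
    then have "a k + f k X = 0" by (simp add: a_def f_def algebra_simps)
    then show ?thesis by blast
  qed
  have "\<exists>k\<in>UNIV. a k = 0 \<and> (\<forall>X. f k X = 0)"
    by (rule affine_maps_cover_ball[OF _ _ lin_f cover]) simp_all
  then show ?thesis by (auto simp: a_def f_def)
qed

text \<open>The coefficient with which row \<open>a\<close> of \<open>X\<close> enters row \<open>k\<close> of \<open>\<Phi> (C X)\<close> is the same for all
  \<open>a\<close>, except at \<open>a = \<pi> k\<close>. The alternative \<open>r = 0\<close> corresponds to \<open>R = 0\<close>.\<close>

lemma preserver_coefficients: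
  fixes \<Phi> :: "real ^ 'm ^ 'n \<Rightarrow> real ^ 'm ^ 'n"
  assumes lin: "linear \<Phi>"
    and pres: "preserves_strong_majorization_on column_stochastic \<Phi>"
  obtains \<pi> c r where "\<pi> permutes UNIV"
    and "\<And>k a j. \<Phi> (center_columns (single_entry a j)) $ k = c k j + (if a = \<pi> k then r j else 0)"
    and "r = (\<lambda>_. 0) \<or>
      (\<forall>k i. c k = c i \<and> \<Phi> (\<chi> i j. 1 / real CARD('n)) $ k = \<Phi> (\<chi> i j. 1 / real CARD('n)) $ i)"
proof -
  define s where "s k = \<Phi> (\<chi> i j. 1 / real CARD('n)) $ k" for k
  define f where "f k a j = \<Phi> (center_columns (single_entry a j)) $ k" for k a j
  have closed: "\<exists>k. s k = s i \<and> f k = f i \<circ> q" if q: "q permutes UNIV" for q i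
  proof -
    obtain k where k: "s k = s i" and
      L: "\<And>X. \<Phi> (center_columns X) $ k = \<Phi> (center_columns (permute_rows (inv q) X)) $ i"
      using preserver_permutes_rows[OF lin pres permutes_inv[OF q], of i] by (auto simp: s_def)
    have "permute_rows (inv q) (single_entry a j) = (single_entry (q a) j :: real ^ 'm ^ 'n)" for a j
      using permute_single_entry[OF permutes_inv[OF q], of "q a" j] permutes_inverses[OF q] by simp
    then have "f k = f i \<circ> q" by (simp add: fun_eq_iff f_def L)
    then show ?thesis using k by blast
  qed
  show ?thesis
  proof (cases "\<forall>i. \<exists>c. f i = (\<lambda>_. c)")
    case True
    then obtain c where "\<And>i. f i = (\<lambda>_. c i)" by metis
    then have "f k a j = c k j" for k a j by simp
    then show ?thesis
      by (intro that[of id c "\<lambda>_. 0"]) (simp_all add: f_def permutes_id)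
  next
    case False
    then obtain \<pi> c d where \<pi>: "\<pi> permutes UNIV" and f: "\<And>k. f k = (\<lambda>a. if a = \<pi> k then d else c)"
      and s: "\<And>k i. s k = s i"
      using closed_family_constant_or_spikes[of s f, OF closed] by blast
    have "f k a j = c j + (if a = \<pi> k then d j - c j else 0)" for k a j by (simp add: f)
    then show ?thesis
      using \<pi> s by (intro that[of \<pi> "\<lambda>_. c" "\<lambda>j. d j - c j"]) (auto simp: f_def s_def)
  qed
qed

text \<open>Splitting \<open>X\<close> into its centred part and its column means, the common coefficients \<open>c\<close> and the
  images of the means contribute multiples of the column sums of \<open>X\<close>, which make up the \<open>S\<^sub>j\<close>;
  the exceptional coefficients \<open>r\<close> are the rows of \<open>R\<close>.\<close>

lemma preserver_has_form:
  fixes \<Phi> :: "real ^ 'm ^ 'n \<Rightarrow> real ^ 'm ^ 'n"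
  assumes lin: "linear \<Phi>"
    and pres: "preserves_strong_majorization_on column_stochastic \<Phi>"
  shows "\<exists>(S :: 'm \<Rightarrow> real ^ 'm ^ 'n) (R :: real ^ 'm ^ 'm) (P :: real ^ 'n ^ 'n).
       P \<in> permutation_matrices \<and>
       (\<forall>X. \<Phi> X = (\<Sum>j\<in>UNIV. (ones \<bullet> column j X) *\<^sub>R S j) + P ** X ** R) \<and>
       (R \<noteq> 0 \<longrightarrow> (\<exists>v. (\<Sum>j\<in>UNIV. S j) = outer_product ones v))"
proof -
  obtain \<pi> c r where \<pi>: "\<pi> permutes UNIV"
    and coeff: "\<And>k a j. \<Phi> (center_columns (single_entry a j)) $ k
      = c k j + (if a = \<pi> k then r j else 0)"
    and const: "r = (\<lambda>_. 0) \<or> (\<forall>k i. c k = c i \<and>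
      \<Phi> (\<chi> i j. 1 / real CARD('n)) $ k = \<Phi> (\<chi> i j. 1 / real CARD('n)) $ i)"
    using preserver_coefficients[OF lin pres] by metis
  define mean :: "'m \<Rightarrow> real ^ 'm ^ 'n"
    where "mean j = (\<chi> i k. if k = j then 1 / real CARD('n) else 0)" for j
  define S where "S j = \<Phi> (mean j) + (\<chi> k. c k j)" for j
  define R :: "real ^ 'm ^ 'm" where "R = (\<chi> j. r j)"
  define P :: "real ^ 'n ^ 'n" where "P = (\<chi> i j. if j = \<pi> i then 1 else 0)"
  have "P \<in> permutation_matrices" using \<pi> by (auto simp: P_def permutation_matrices_def)
  moreover have "\<Phi> X = (\<Sum>j\<in>UNIV. (ones \<bullet> column j X) *\<^sub>R S j) + P ** X ** R" for X
  proof -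
    have colsum: "ones \<bullet> column j X = (\<Sum>a\<in>UNIV. X $ a $ j)" for j
      by (simp add: ones_def column_def inner_vec_def)
    have "X = center_columns X + (\<Sum>j\<in>UNIV. (ones \<bullet> column j X) *\<^sub>R mean j)"
      by (simp add: vec_eq_iff center_columns_def mean_def colsum if_distrib[of "\<lambda>x. _ * x"]
          cong: if_cong)
    then have "\<Phi> X = \<Phi> (center_columns X + (\<Sum>j\<in>UNIV. (ones \<bullet> column j X) *\<^sub>R mean j))" by simp
    also have "\<dots> = \<Phi> (center_columns X) + (\<Sum>j\<in>UNIV. (ones \<bullet> column j X) *\<^sub>R \<Phi> (mean j))"
      by (simp add: linear_add[OF lin] linear_sum[OF lin] linear_scale[OF lin])
    finally have split: "\<Phi> X = \<dots>" .
    have "\<Phi> (center_columns X) $ k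
        = (\<Sum>j\<in>UNIV. (ones \<bullet> column j X) *\<^sub>R c k j) + (P ** X ** R) $ k" for k
    proof -
      have "\<Phi> (center_columns X)
          = (\<Sum>a\<in>UNIV. \<Sum>j\<in>UNIV. X $ a $ j *\<^sub>R \<Phi> (center_columns (single_entry a j)))"
        by (subst matrix_as_sum_single_entry[of X])
          (simp only: linear_sum[OF lin] linear_scale[OF lin] linear_sum[OF linear_center_columns]
            linear_scale[OF linear_center_columns])
      then have "\<Phi> (center_columns X) $ k = (\<Sum>a\<in>UNIV. \<Sum>j\<in>UNIV. X $ a $ j *\<^sub>R c k j)
          + (\<Sum>a\<in>UNIV. \<Sum>j\<in>UNIV. X $ a $ j *\<^sub>R (if a = \<pi> k then r j else 0))"
        by (simp add: coeff scaleR_add_right sum.distrib)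
      also have "(\<Sum>a\<in>UNIV. \<Sum>j\<in>UNIV. X $ a $ j *\<^sub>R c k j)
          = (\<Sum>j\<in>UNIV. (ones \<bullet> column j X) *\<^sub>R c k j)"
        by (subst sum.swap) (simp add: colsum scaleR_sum_left)
      also have "(\<Sum>a\<in>UNIV. \<Sum>j\<in>UNIV. X $ a $ j *\<^sub>R (if a = \<pi> k then r j else 0))
          = (\<Sum>a\<in>UNIV. if a = \<pi> k then \<Sum>j\<in>UNIV. X $ a $ j *\<^sub>R r j else 0)"
        by (intro sum.cong) auto
      also have "\<dots> = (P ** X ** R) $ k"
        unfolding row_matrix_mult[of "P ** X"]
        by (simp add: P_def permutation_matrix_mult permute_rows_def R_def)
      finally show ?thesis .
    qed
    then show ?thesis
      by (subst split)
        (simp add: S_def vec_eq_iff[of "_ :: real ^ 'm ^ 'n"] scaleR_add_right sum.distrib)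
  qed
  moreover have "\<exists>v. (\<Sum>j\<in>UNIV. S j) = outer_product ones v" if "R \<noteq> 0"
  proof -
    have "r \<noteq> (\<lambda>_. 0)" using that by (auto simp: R_def vec_eq_iff)
    have sum_mean: "(\<Sum>j\<in>UNIV. mean j) = (\<chi> i j. 1 / real CARD('n))"
      by (simp add: mean_def vec_eq_iff)
    have row: "(\<Sum>j\<in>UNIV. S j) $ k
        = \<Phi> (\<chi> i j. 1 / real CARD('n)) $ k + (\<Sum>j\<in>UNIV. c k j)" for k
      by (simp add: S_def sum.distrib sum_mean[symmetric] linear_sum[OF lin])
    \<comment> \<open>All rows agree, so any of them, here one at an arbitrary index, serves as \<open>v\<^sup>t\<close>.\<close>
    have "(\<Sum>j\<in>UNIV. S j) $ k = (\<Sum>j\<in>UNIV. S j) $ undefined" for k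
      unfolding row using const \<open>r \<noteq> (\<lambda>_. 0)\<close> by metis
    then have "(\<Sum>j\<in>UNIV. S j) = outer_product ones ((\<Sum>j\<in>UNIV. S j) $ undefined)"
      by (simp add: vec_eq_iff[of "_ :: real ^ 'm ^ 'n"]) (simp add: vec_eq_iff outer_product_def
          matrix_matrix_mult_def columnvector_def rowvector_def ones_def)
    then show ?thesis by blast
  qed
  ultimately show ?thesis by blast
qed

section \<open>Sufficiency\<close>

lemma form_preserves_majorization:
  fixes \<Phi> :: "real ^ 'm ^ 'n \<Rightarrow> real ^ 'm ^ 'n"
  assumes P: "P \<in> permutation_matrices"
    and form: "\<And>X. \<Phi> X = (\<Sum>j\<in>UNIV. (ones \<bullet> column j X) *\<^sub>R S j) + P ** X ** R"
    and rows: "R \<noteq> 0 \<Longrightarrow> (\<Sum>j\<in>UNIV. S j) = outer_product ones v"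
  shows "preserves_strong_majorization_on column_stochastic \<Phi>"
proof -
  obtain p where p: "p permutes UNIV" "P = (\<chi> i j. if j = p i then 1 else 0)"
    using P by (auto simp: permutation_matrices_def)
  have val: "\<Phi> X = (\<Sum>j\<in>UNIV. S j) + permute_rows p X ** R" if "X \<in> column_stochastic" for X
    using that
    by (simp add: form p(2) permutation_matrix_mult ones_def column_def inner_vec_def
        column_stochastic_def)
  have "\<Phi> (D ** B) \<preceq>\<^sub>s \<Phi> B"
    if D: "D \<in> doubly_stochastic" and B: "B \<in> column_stochastic"
      and DB: "D ** B \<in> column_stochastic" for D B
  proof (cases "R = 0")
    case True
    have "mat 1 \<in> (doubly_stochastic :: (real ^ 'n ^ 'n) set)"
      by (simp add: doubly_stochastic_def mat_def)
    moreover have "\<Phi> (D ** B) = mat 1 ** \<Phi> B" by (simp add: val[OF B] val[OF DB] True)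
    ultimately show ?thesis unfolding strongly_majorized_def by blast
  next
    case False
    \<comment> \<open>This is \<open>P D P\<^sup>t\<close>.\<close>
    define D' :: "real ^ 'n ^ 'n" where "D' = (\<chi> i j. D $ p i $ p j)"
    have reindex: "(\<Sum>j\<in>UNIV. g (p j)) = (\<Sum>j\<in>UNIV. g j)" for g :: "'n \<Rightarrow> real"
      using sum.permute[OF p(1), of g] by (simp add: o_def)
    have D': "D' \<in> doubly_stochastic"
      using D reindex[of "\<lambda>j. D $ _ $ j"] reindex[of "\<lambda>i. D $ i $ _"]
      by (simp add: doubly_stochastic_def D'_def)
    have "D' ** permute_rows p B = permute_rows p (D ** B)"
      using reindex[of "\<lambda>k. D $ _ $ k * B $ k $ _"]
      by (simp add: vec_eq_iff matrix_matrix_mult_def D'_def permute_rows_def)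
    moreover have "D' ** outer_product ones v = outer_product ones v"
      using D' by (simp add: doubly_stochastic_def vec_eq_iff matrix_matrix_mult_def
          outer_product_def columnvector_def rowvector_def ones_def sum_distrib_right[symmetric])
    ultimately have "D' ** \<Phi> B = \<Phi> (D ** B)"
      by (simp add: val[OF B] val[OF DB] rows[OF False] matrix_add_ldistrib matrix_mul_assoc)
    then show ?thesis using D' unfolding strongly_majorized_def by metis
  qed
  then show ?thesis
    unfolding preserves_strong_majorization_on_def by (metis strongly_majorized_def)
qed

section \<open>Characterization of the preservers\<close>

theorem theorem6p19:
  fixes \<Phi> :: "real ^ 'm ^ 'n \<Rightarrow> real ^ 'm ^ 'n"
  assumes "linear \<Phi>"
  shows "preserves_strong_majorization_on column_stochastic \<Phi> \<longleftrightarrow>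
    (\<exists>(S :: 'm \<Rightarrow> real ^ 'm ^ 'n) (R :: real ^ 'm ^ 'm) (P :: real ^ 'n ^ 'n).
       P \<in> permutation_matrices \<and>
       (\<forall>X. \<Phi> X = (\<Sum>j\<in>UNIV. (ones \<bullet> column j X) *\<^sub>R S j) + P ** X ** R) \<and>
       (R \<noteq> 0 \<longrightarrow> (\<exists>v. (\<Sum>j\<in>UNIV. S j) = outer_product ones v)))"
proof
  assume "preserves_strong_majorization_on column_stochastic \<Phi>"
  then show "\<exists>S R P. P \<in> permutation_matrices \<and>
      (\<forall>X. \<Phi> X = (\<Sum>j\<in>UNIV. (ones \<bullet> column j X) *\<^sub>R S j) + P ** X ** R) \<and>
      (R \<noteq> 0 \<longrightarrow> (\<exists>v. (\<Sum>j\<in>UNIV. S j) = outer_product ones v))"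
    by (rule preserver_has_form[OF assms])
next
  assume "\<exists>S R P. P \<in> permutation_matrices \<and>
      (\<forall>X. \<Phi> X = (\<Sum>j\<in>UNIV. (ones \<bullet> column j X) *\<^sub>R S j) + P ** X ** R) \<and>
      (R \<noteq> 0 \<longrightarrow> (\<exists>v. (\<Sum>j\<in>UNIV. S j) = outer_product ones v))"
  then obtain S R P v where "P \<in> permutation_matrices"
    and "\<And>X. \<Phi> X = (\<Sum>j\<in>UNIV. (ones \<bullet> column j X) *\<^sub>R S j) + P ** X ** R"
    and "R \<noteq> 0 \<Longrightarrow> (\<Sum>j\<in>UNIV. S j) = outer_product ones v"
    by blast
  then show "preserves_strong_majorization_on column_stochastic \<Phi>"
    by (rule form_preserves_majorization)
qed

end
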